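(* Let the data and the problems (P) and (R) be as defined in the context, and assume that the step $h$ satisfies $$(1-h\gamma)\,\bar w-hg(1+c)>\left(\frac{P_{\max}h}{2M(\lambda\gamma P_{\max}h+1)}\right)^{2/3}.$$ Let $I=\{i\in\{1,\dots,n\}: w^{\max}_i>\bar w\}$ and assume moreover that $$\min_{i\in I}\left[\frac{P_{\max}}{M}\sqrt{\frac{1-h\gamma}{\bar w+hg(\sin\alpha_i+c)}}-\frac{\gamma}{1-h\gamma}\big(\bar w+hg(\sin\alpha_i+c)\big)-g(\sin\alpha_i+c)\right]\ge 0 .$$ Then, for every optimal solution $(w^*,t^*,f^* )$ of the relaxed problem (R), the pair $(w,F)=(w^*,Mf^* )$ is feasible for (P) and, thus, is an optimal solution of (P).
   Context: Data: an integer $n\ge 2$; positive constants $h,M,g,\mu,c,\Gamma,P_{\max}$; constants $\lambda\ge 0$ and $\eta\in[0,1]$; angles $\alpha_1,\dots,\alpha_n\in\mathbb{R}$; bounds $w^{\max}_1,\dots,w^{\max}_n>0$; $w_{\mathrm{init}}\ge 0$. Put $\gamma:=\Gamma/M$, and let $\bar w>0$ (the critical squared speed) be the solution of $\frac{P_{\max}}{M\sqrt{\bar w}}=g\mu$. Problem (P) (non-convex), in variables $w\in\mathbb{R}^n$, $F\in\mathbb{R}^{n-1}$: minimize $$\sum_{i=1}^{n-1}h\Big(\lambda\max\{\eta F_i,F_i\}+\frac1{\sqrt{w_i}}\Big)$$ subject to: $0\le w_i\le w^{\max}_i$ for $i\in\{1,\dots,n\}$; $w_1=w_{\mathrm{init}}$;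 and, for $i\in\{1,\dots,n-1\}$: $|F_i|\le Mg\mu$, $F_i\sqrt{w_i}\le P_{\max}$, and $\frac Mh(w_{i+1}-w_i)=-\Gamma w_i+F_i-Mg\sin\alpha_i-Mgc$. Problem (R) (convex relaxation), in variables $w\in\mathbb{R}^n$, $t,f\in\mathbb{R}^{n-1}$: minimize $$\sum_{i=1}^{n-1}h\big(\lambda M\max\{\eta f_i,f_i\}+t_i\big)$$ subject to: $0\le w_i\le w^{\max}_i$ for $i\in\{1,\dots,n\}$; $w_1=w_{\mathrm{init}}$; and, for $i\in\{1,\dots,n-1\}$: $|f_i|\le g\mu$, $t_i\ge \frac1{\sqrt{w_i}}$, $t_i\ge\frac{Mf_i}{P_{\max}}$, and $f_i=\frac1h(w_{i+1}-w_i)+\gamma w_i+g(\sin\alpha_i+c)$. Conventions: expressions $1/\sqrt{w_i}$ in (P) and (R) require $w_i>0$ for $i\in\{1,\dots,n-1\}$; a minimum over the empty set is $+\infty$ (so the condition over $I$ is vacuous if $I=\emptyset$). *)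

theory Defs
  imports Complex_Main
begin

text \<open>Vectors indexed by \<open>1, \<dots>, m\<close> are functions \<open>nat \<Rightarrow> real\<close>; only the entries at
  these indices are constrained or occur in the objectives, the remaining entries are irrelevant.
  The constraint \<open>0 < w i\<close> for \<open>i \<le> n - 1\<close> makes \<open>1 / sqrt (w i)\<close> meaningful
  (in HOL \<open>1 / sqrt 0 = 0\<close>).\<close>

definition P_feasible ::
  "nat \<Rightarrow> real \<Rightarrow> real \<Rightarrow> real \<Rightarrow> real \<Rightarrow> real \<Rightarrow> real \<Rightarrow> real \<Rightarrow>
   (nat \<Rightarrow> real) \<Rightarrow> (nat \<Rightarrow> real) \<Rightarrow> real \<Rightarrow>
   (nat \<Rightarrow> real) \<times> (nat \<Rightarrow> real) \<Rightarrow> bool" where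
  "P_feasible n h M g \<mu> c \<Gamma> Pmax \<alpha> wmax winit = (\<lambda>(w, F).
     (\<forall>i\<in>{1..n}. 0 \<le> w i \<and> w i \<le> wmax i) \<and>
     w 1 = winit \<and>
     (\<forall>i\<in>{1..n-1}.
        0 < w i \<and>
        \<bar>F i\<bar> \<le> M * g * \<mu> \<and>
        F i * sqrt (w i) \<le> Pmax \<and>
        M / h * (w (i + 1) - w i) = - \<Gamma> * w i + F i - M * g * sin (\<alpha> i) - M * g * c))"

definition P_objective ::
  "nat \<Rightarrow> real \<Rightarrow> real \<Rightarrow> real \<Rightarrow> (nat \<Rightarrow> real) \<times> (nat \<Rightarrow> real) \<Rightarrow> real" where
  "P_objective n h lam \<eta> = (\<lambda>(w, F).
     \<Sum>i=1..n-1. h * (lam * max (\<eta> * F i) (F i) + 1 / sqrt (w i)))"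

definition R_feasible ::
  "nat \<Rightarrow> real \<Rightarrow> real \<Rightarrow> real \<Rightarrow> real \<Rightarrow> real \<Rightarrow> real \<Rightarrow> real \<Rightarrow>
   (nat \<Rightarrow> real) \<Rightarrow> (nat \<Rightarrow> real) \<Rightarrow> real \<Rightarrow>
   (nat \<Rightarrow> real) \<times> (nat \<Rightarrow> real) \<times> (nat \<Rightarrow> real) \<Rightarrow> bool" where
  "R_feasible n h M g \<mu> c \<gamma> Pmax \<alpha> wmax winit = (\<lambda>(w, t, f).
     (\<forall>i\<in>{1..n}. 0 \<le> w i \<and> w i \<le> wmax i) \<and>
     w 1 = winit \<and>
     (\<forall>i\<in>{1..n-1}.
        0 < w i \<and>
        \<bar>f i\<bar> \<le> g * \<mu> \<and>
        t i \<ge> 1 / sqrt (w i) \<and>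
        t i \<ge> M * f i / Pmax \<and>
        f i = 1 / h * (w (i + 1) - w i) + \<gamma> * w i + g * (sin (\<alpha> i) + c)))"

definition R_objective ::
  "nat \<Rightarrow> real \<Rightarrow> real \<Rightarrow> real \<Rightarrow> real \<Rightarrow>
   (nat \<Rightarrow> real) \<times> (nat \<Rightarrow> real) \<times> (nat \<Rightarrow> real) \<Rightarrow> real" where
  "R_objective n h M lam \<eta> = (\<lambda>(w, t, f).
     \<Sum>i=1..n-1. h * (lam * M * max (\<eta> * f i) (f i) + t i))"

end

theory Submission
  imports Defs
begin

text \<open>
  Every feasible point of (P) yields one of (R) with the same cost, so it suffices that the power
  constraint \<open>M f\<^sub>i \<surd>w\<^sub>i \<le> Pmax\<close> holds at each optimum of (R). Otherwise take the largest
  violated index \<open>i\<close>. The bound \<open>f\<^sub>i \<le> g \<mu>\<close> forces \<open>w\<^sub>i > wbar\<close>, and the minimum condition over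
  \<open>I\<close> then forces \<open>w\<^sub>i\<^sub>+\<^sub>1 > wbar\<close>, so \<open>f\<^sub>i\<^sub>+\<^sub>1 < g \<mu>\<close> by maximality of \<open>i\<close>. Hence \<open>w\<^sub>i\<^sub>+\<^sub>1\<close> can be
  decreased slightly. Per unit of decrease \<open>t\<^sub>i\<close> gains \<open>M / (Pmax h)\<close> and the traction term gains at
  least \<open>lam \<gamma> M\<close>, while the loss in \<open>t\<^sub>i\<^sub>+\<^sub>1\<close> has a smaller rate by the assumption on \<open>h\<close>. This
  contradicts optimality.
\<close>

text \<open>Both branches of the maximum have slope at most 1 in \<open>x\<close>.\<close>

lemma max_scaled_add_le:
  fixes \<eta> x d :: real
  assumes "\<eta> \<le> 1" "0 \<le> d"
  shows "max (\<eta> * (x + d)) (x + d) \<le> max (\<eta> * x) x + d"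
proof -
  have "\<eta> * d \<le> 1 * d"
    using assms by (rule mult_right_mono)
  then show ?thesis
    by (auto simp: max_def algebra_simps)
qed

text \<open>Raise to the power 3/2 and use \<open>y powr (3 / 2) = y * sqrt y\<close>. This turns
  the exponent 2/3 in the assumption on \<open>h\<close> into a bound on the derivative of the
  inverse square root.\<close>

lemma less_mult_sqrt_if_powr_less:
  fixes x y :: real
  assumes "0 \<le> x" "x powr (2 / 3) < y"
  shows "x < y * sqrt y"
proof -
  have "y > 0"
    using assms(2) powr_ge_zero[of x "2 / 3"] by linarith
  have "x = (x powr (2 / 3)) powr (3 / 2)"
    using assms(1) by (simp add: powr_powr)
  also have "\<dots> < y powr (1 + 1 / 2)"
    using assms(2) by (simp add: powr_less_mono2)
  also have "\<dots> = y * sqrt y"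
    using \<open>y > 0\<close> by (simp only: powr_add powr_one powr_half_sqrt less_imp_le)
  finally show ?thesis .
qed

text \<open>At \<open>e = 0\<close> the left side has derivative
  \<open>1 / (2 * v * sqrt v)\<close>, so subtracting \<open>K * e\<close> leaves a function with
  negative derivative there.\<close>

lemma eventually_inverse_sqrt_le:
  fixes v K :: real
  assumes "v > 0" "1 / (2 * v * sqrt v) < K"
  shows "eventually (\<lambda>e. 1 / sqrt (v - e) \<le> 1 / sqrt v + K * e) (at_right 0)"
proof -
  have "((\<lambda>e. 1 / sqrt (v - e) - K * e) has_real_derivative 1 / (2 * v * sqrt v) - K) (at 0)"
    using assms(1) by (auto intro!: derivative_eq_intros simp: field_simps)
  from DERIV_neg_dec_right[OF this] assms(2) obtain d where
    "d > 0" "\<And>e. 0 < e \<Longrightarrow> e < d \<Longrightarrow> 1 / sqrt (v - e) - K * e < 1 / sqrt v"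
    by auto
  then show ?thesis
    unfolding eventually_at_right_field by (intro exI[of _ d]) (auto simp: less_imp_le field_simps)
qed

lemma eventually_mult_less_at_right_0:
  fixes a k :: real
  assumes "a > 0"
  shows "eventually (\<lambda>e. k * e < a) (at_right 0)"
proof -
  have "((\<lambda>e. k * e) \<longlongrightarrow> k * 0) (at_right 0)"
    by (intro tendsto_intros)
  then show ?thesis
    using assms by (simp add: order_tendsto_iff)
qed

text \<open>Only \<open>w (i + 1)\<close> is lowered, by a small \<open>e\<close>; the dynamics then
  dictate \<open>f i\<close> and \<open>f (i + 1)\<close>. Strict violation of the power bound
  leaves \<open>t i\<close> above \<open>1 / sqrt (w i)\<close>, so \<open>t i\<close> may fall
  together with \<open>f i\<close>.\<close>

lemma R_descent:
  fixes n i :: nat and h M g \<mu> c \<gamma> Pmax lam \<eta> winit :: real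
    and \<alpha> wmax w t f :: "nat \<Rightarrow> real"
  assumes pos: "h > 0" "M > 0" "\<gamma> > 0" "Pmax > 0"
    and "lam \<ge> 0" "\<eta> \<le> 1" and h\<gamma>: "h * \<gamma> < 1"
    and feas: "R_feasible n h M g \<mu> c \<gamma> Pmax \<alpha> wmax winit (w, t, f)"
    and i: "i \<in> {1..n-1}"
    and viol: "1 / sqrt (w i) < M * f i / Pmax"
    and w_next: "w (i + 1) > 0"
    and rate: "1 / (2 * w (i + 1) * sqrt (w (i + 1))) < M / (Pmax * h) + lam * \<gamma> * M"
    and f_next: "i + 1 \<in> {1..n-1} \<Longrightarrow> f (i + 1) < g * \<mu>"
  obtains y where "R_feasible n h M g \<mu> c \<gamma> Pmax \<alpha> wmax winit y"
    and "R_objective n h M lam \<eta> y < R_objective n h M lam \<eta> (w, t, f)"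
proof -
  have R: "\<And>k. k \<in> {1..n} \<Longrightarrow> 0 \<le> w k \<and> w k \<le> wmax k" "w 1 = winit"
    "\<And>k. k \<in> {1..n-1} \<Longrightarrow> 0 < w k \<and> \<bar>f k\<bar> \<le> g * \<mu> \<and> t k \<ge> 1 / sqrt (w k) \<and> t k \<ge> M * f k / Pmax"
    "\<And>k. k \<in> {1..n-1} \<Longrightarrow> f k = 1 / h * (w (k + 1) - w k) + \<gamma> * w k + g * (sin (\<alpha> k) + c)"
    using feas unfolding R_feasible_def prod.case by blast+
  have "0 < 1 / sqrt (w i)" using R(3)[OF i] by simp
  then have "0 < M * f i / Pmax" using viol by linarith
  then have fi: "f i > 0" using pos by (simp add: zero_less_mult_iff zero_less_divide_iff)
  \<comment> \<open>In the dynamics \<open>w k\<close> enters \<open>f k\<close> with coefficient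
    \<open>-r\<close>, so lowering \<open>w (i + 1)\<close> by \<open>e\<close> raises
    \<open>f (i + 1)\<close> by \<open>r * e\<close>.\<close>
  define r where "r = 1 / h - \<gamma>"
  have r: "r > 0" using h\<gamma> pos by (simp add: r_def field_simps)
  \<comment> \<open>\<open>L\<close> is the break-even rate: the gain in \<open>t i\<close> plus the
    net traction gain \<open>lam * M * (1 / h - r)\<close>, per unit of \<open>e\<close>.\<close>
  define L where "L = M / (Pmax * h) + lam * \<gamma> * M"
  have "M / Pmax * r < M / (Pmax * h)"
    using pos by (simp add: r_def field_simps)
  also have "\<dots> \<le> L" using pos \<open>lam \<ge> 0\<close> by (simp add: L_def)
  finally have "max (M / Pmax * r) (1 / (2 * w (i + 1) * sqrt (w (i + 1)))) < L"
    using rate by (simp add: L_def)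
  \<comment> \<open>\<open>K\<close> is the growth rate of \<open>t (i + 1)\<close>: fast enough for
    both of its lower bounds, yet slower than the gain \<open>L\<close>.\<close>
  from dense[OF this] obtain K where
    K: "M / Pmax * r < K" "1 / (2 * w (i + 1) * sqrt (w (i + 1))) < K" "K < L"
    by auto
  have "eventually (\<lambda>e. i + 1 \<in> {1..n-1} \<longrightarrow> r * e < g * \<mu> - f (i + 1)) (at_right 0)"
    using f_next eventually_mult_less_at_right_0[of "g * \<mu> - f (i + 1)" r]
    by (cases "i + 1 \<in> {1..n-1}") auto
  \<comment> \<open>Positivity of \<open>f i - e / h\<close> preserves the force bound at
    \<open>i\<close> and makes the traction term linear there.\<close>
  then have "eventually (\<lambda>e. e > 0 \<and> 1 * e < w (i + 1) \<and> 1 / h * e < f i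
      \<and> M / (Pmax * h) * e < M * f i / Pmax - 1 / sqrt (w i)
      \<and> 1 / sqrt (w (i + 1) - e) \<le> 1 / sqrt (w (i + 1)) + K * e
      \<and> (i + 1 \<in> {1..n-1} \<longrightarrow> r * e < g * \<mu> - f (i + 1))) (at_right 0)"
    using viol fi w_next K(2)
    by (intro eventually_conj eventually_at_right_less eventually_mult_less_at_right_0
        eventually_inverse_sqrt_le) simp_all
  then obtain e where e: "e > 0" "e < w (i + 1)" "e / h < f i"
      "M / (Pmax * h) * e < M * f i / Pmax - 1 / sqrt (w i)"
      "1 / sqrt (w (i + 1) - e) \<le> 1 / sqrt (w (i + 1)) + K * e"
      "i + 1 \<in> {1..n-1} \<Longrightarrow> r * e < g * \<mu> - f (i + 1)"
    using eventually_happens'[OF trivial_limit_at_right_real] by fastforce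
  define w' where "w' = w(i + 1 := w (i + 1) - e)"
  \<comment> \<open>If \<open>i + 1 = n\<close>, the changed entries \<open>t (i + 1)\<close> and
    \<open>f (i + 1)\<close> are neither constrained nor part of the cost.\<close>
  define t' where "t' = t(i := t i - M / (Pmax * h) * e, i + 1 := t (i + 1) + K * e)"
  define f' where "f' = f(i := f i - e / h, i + 1 := f (i + 1) + r * e)"
  have Kpos: "K > 0"
    using K(1) r pos by (meson divide_pos_pos less_trans mult_pos_pos)

  \<comment> \<open>Feasibility of the perturbed point\<close>
  have "R_feasible n h M g \<mu> c \<gamma> Pmax \<alpha> wmax winit (w', t', f')"
    unfolding R_feasible_def prod.case
  proof (intro conjI ballI)
    fix k assume "k \<in> {1..n}"
    then show "0 \<le> w' k" "w' k \<le> wmax k"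
      using R(1)[of k] e(1,2) by (auto simp: w'_def)
  next
    show "w' 1 = winit" using R(2) i by (auto simp: w'_def)
  next
    fix k assume k: "k \<in> {1..n-1}"
    consider (here) "k = i" | (nxt) "k = i + 1" | (other) "k \<noteq> i" "k \<noteq> i + 1" by blast
    note cs = this
    show "0 < w' k" using R(3)[OF k] e(2) by (auto simp: w'_def)
    show "\<bar>f' k\<bar> \<le> g * \<mu>"
      using cs
    proof cases
      case here
      have "0 \<le> e / h" using e(1) pos by simp
      then show ?thesis using here R(3)[OF k] e(3) by (auto simp: f'_def)
    next
      case nxt
      have "0 \<le> r * e" using e(1) r by simp
      then show ?thesis using nxt R(3)[OF k] e(6) k by (auto simp: f'_def)
    next
      case other
      then show ?thesis using R(3)[OF k] by (simp add: f'_def)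
    qed
    show "1 / sqrt (w' k) \<le> t' k"
      using cs
    proof cases
      case here
      then show ?thesis using R(3)[OF k] e(4) by (auto simp: w'_def t'_def)
    next
      case nxt
      then show ?thesis using R(3)[OF k] e(5) by (auto simp: w'_def t'_def)
    next
      case other
      then show ?thesis using R(3)[OF k] by (simp add: w'_def t'_def)
    qed
    show "M * f' k / Pmax \<le> t' k"
      using cs
    proof cases
      case here
      have "M * (f i - e / h) / Pmax = M * f i / Pmax - M / (Pmax * h) * e"
        using pos by (simp add: field_simps)
      then show ?thesis using here R(3)[OF k] by (auto simp: f'_def t'_def)
    next
      case nxt
      have "M * (f (i + 1) + r * e) / Pmax = M * f (i + 1) / Pmax + M / Pmax * r * e"
        using pos by (simp add: field_simps)
      moreover have "M / Pmax * r * e \<le> K * e"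
        using K(1) e(1) by (intro mult_right_mono) auto
      ultimately show ?thesis using nxt R(3)[OF k] by (auto simp: f'_def t'_def)
    next
      case other
      then show ?thesis using R(3)[OF k] by (simp add: f'_def t'_def)
    qed
    note fk = R(4)[OF k]
    show "f' k = 1 / h * (w' (k + 1) - w' k) + \<gamma> * w' k + g * (sin (\<alpha> k) + c)"
      using cs
    proof cases
      case here
      then show ?thesis using fk by (simp add: f'_def w'_def diff_divide_distrib)
    next
      case nxt
      then show ?thesis using fk pos
        by (simp add: f'_def w'_def r_def diff_divide_distrib algebra_simps)
    next
      case other
      then show ?thesis using fk by (simp add: f'_def w'_def)
    qed
  qed

  \<comment> \<open>Strict decrease of the cost\<close>
  moreover have "R_objective n h M lam \<eta> (w', t', f') < R_objective n h M lam \<eta> (w, t, f)"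
  proof -
    define C where "C x s = h * (lam * M * max (\<eta> * x) x + s)" for x s
    \<comment> \<open>\<open>a\<close> is the exact change of the cost at \<open>i\<close>;
      \<open>b\<close> bounds the change at \<open>i + 1\<close> from above.\<close>
    define a where "a = - (h * e * (M * lam / h + M / (Pmax * h)))"
    define b where "b = h * e * (M * lam * r + K)"
    have lM: "lam * M \<ge> 0" using \<open>lam \<ge> 0\<close> pos by simp
    have max_scaled: "max (\<eta> * x) x = x" if "x \<ge> 0" for x
      using that \<open>\<eta> \<le> 1\<close> mult_right_mono[of \<eta> 1 x] by auto
    have a: "C (f' i) (t' i) = C (f i) (t i) + a"
      using fi e(3) max_scaled[of "f i"] max_scaled[of "f i - e / h"]
      by (simp add: C_def f'_def t'_def a_def)
        (simp add: algebra_simps)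
    have "lam * M * max (\<eta> * (f (i + 1) + r * e)) (f (i + 1) + r * e)
        \<le> lam * M * (max (\<eta> * f (i + 1)) (f (i + 1)) + r * e)"
      using lM \<open>\<eta> \<le> 1\<close> r e(1) by (intro mult_left_mono max_scaled_add_le) auto
    then have "h * (lam * M * max (\<eta> * (f (i + 1) + r * e)) (f (i + 1) + r * e) + (t (i + 1) + K * e))
        \<le> h * (lam * M * (max (\<eta> * f (i + 1)) (f (i + 1)) + r * e) + (t (i + 1) + K * e))"
      using pos by (intro mult_left_mono) auto
    then have b: "C (f' (i + 1)) (t' (i + 1)) \<le> C (f (i + 1)) (t (i + 1)) + b"
      by (simp add: C_def f'_def t'_def b_def algebra_simps)
    have "M * lam * r + K < M * lam / h + M / (Pmax * h)"
      using K(3) by (simp add: L_def r_def algebra_simps)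
    then have ab: "a + b < 0"
      using e(1) pos by (simp add: a_def b_def)
    \<comment> \<open>This covers \<open>i + 1 = n\<close>, where \<open>b\<close> is absent from
      the sum and \<open>a < 0\<close> must hold by itself.\<close>
    have "b \<ge> 0" using e(1) pos r Kpos \<open>lam \<ge> 0\<close> by (simp add: b_def)
    have "(\<Sum>k=1..n-1. C (f' k) (t' k))
        \<le> (\<Sum>k=1..n-1. C (f k) (t k) + ((if k = i then a else 0) + (if k = i + 1 then b else 0)))"
    proof (intro sum_mono)
      fix k
      show "C (f' k) (t' k) \<le> C (f k) (t k) + ((if k = i then a else 0) + (if k = i + 1 then b else 0))"
        using a b by (cases "k = i"; cases "k = i + 1") (auto simp: f'_def t'_def)
    qed
    also have "\<dots> = (\<Sum>k=1..n-1. C (f k) (t k)) + (a + (if i + 1 \<in> {1..n-1} then b else 0))"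
      using i by (simp add: sum.distrib sum.delta)
    also have "\<dots> < (\<Sum>k=1..n-1. C (f k) (t k))"
      using ab \<open>b \<ge> 0\<close> by auto
    finally show ?thesis by (simp add: R_objective_def C_def)
  qed
  ultimately show thesis by (rule that)
qed

theorem proposition3p7:
  fixes n :: nat
    and h M g \<mu> c \<Gamma> Pmax lam \<eta> winit \<gamma> wbar :: real
    and \<alpha> wmax ws ts fs :: "nat \<Rightarrow> real"
    and I :: "nat set"
  assumes "n \<ge> 2"
    and "h > 0" and "M > 0" and "g > 0" and "\<mu> > 0" and "c > 0" and "\<Gamma> > 0" and "Pmax > 0"
    and "lam \<ge> 0" and "0 \<le> \<eta>" and "\<eta> \<le> 1"
    and "\<And>i. i \<in> {1..n} \<Longrightarrow> wmax i > 0"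
    and "winit \<ge> 0"
    and "\<gamma> = \<Gamma> / M"
    and "wbar > 0" and "Pmax / (M * sqrt wbar) = g * \<mu>"
    and "(1 - h * \<gamma>) * wbar - h * g * (1 + c)
           > (Pmax * h / (2 * M * (lam * \<gamma> * Pmax * h + 1))) powr (2 / 3)"
    and "I = {i \<in> {1..n}. wmax i > wbar}"
    and "I \<noteq> {} \<Longrightarrow>
           Min ((\<lambda>i. Pmax / M * sqrt ((1 - h * \<gamma>) / (wbar + h * g * (sin (\<alpha> i) + c)))
                    - \<gamma> / (1 - h * \<gamma>) * (wbar + h * g * (sin (\<alpha> i) + c))
                    - g * (sin (\<alpha> i) + c)) ` I) \<ge> 0"
    and "is_arg_min (R_objective n h M lam \<eta>)
           (R_feasible n h M g \<mu> c \<gamma> Pmax \<alpha> wmax winit) (ws, ts, fs)"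
  shows "P_feasible n h M g \<mu> c \<Gamma> Pmax \<alpha> wmax winit (ws, \<lambda>i. M * fs i)
       \<and> is_arg_min (P_objective n h lam \<eta>)
           (P_feasible n h M g \<mu> c \<Gamma> Pmax \<alpha> wmax winit) (ws, \<lambda>i. M * fs i)"
proof -
  have pos: "h > 0" "M > 0" "g > 0" "\<mu> > 0" "c > 0" "\<Gamma> > 0" "Pmax > 0" "lam \<ge> 0" "wbar > 0"
    and \<gamma>: "\<gamma> > 0" and \<Gamma>: "\<Gamma> = M * \<gamma>"
    using assms by auto
  have Rf: "R_feasible n h M g \<mu> c \<gamma> Pmax \<alpha> wmax winit (ws, ts, fs)"
    and Rmin: "\<And>y. R_feasible n h M g \<mu> c \<gamma> Pmax \<alpha> wmax winit y \<Longrightarrow>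
      \<not> R_objective n h M lam \<eta> y < R_objective n h M lam \<eta> (ws, ts, fs)"
    using assms(20) by (auto simp: is_arg_min_def)
  have R: "\<And>k. k \<in> {1..n} \<Longrightarrow> 0 \<le> ws k \<and> ws k \<le> wmax k" "ws 1 = winit"
    "\<And>k. k \<in> {1..n-1} \<Longrightarrow> 0 < ws k \<and> \<bar>fs k\<bar> \<le> g * \<mu> \<and> ts k \<ge> 1 / sqrt (ws k)
       \<and> ts k \<ge> M * fs k / Pmax"
    "\<And>k. k \<in> {1..n-1} \<Longrightarrow> fs k = 1 / h * (ws (k + 1) - ws k) + \<gamma> * ws k + g * (sin (\<alpha> k) + c)"
    using Rf unfolding R_feasible_def prod.case by blast+

  \<comment> \<open>Consequences of the step-size assumption\<close>
  define D where "D = lam * \<gamma> * Pmax * h + 1"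
  have D: "D > 0" using pos \<gamma> by (simp add: D_def add_nonneg_pos)
  \<comment> \<open>\<open>M * D / (Pmax * h)\<close> is the break-even rate of
    \<open>R_descent\<close>; the base of the power is half its reciprocal.\<close>
  have step: "(Pmax * h / (2 * M * D)) powr (2 / 3) < (1 - h * \<gamma>) * wbar - h * g * (1 + c)"
    using assms(17) by (simp add: D_def)
  have "0 < h * g * (1 + c)" using pos by simp
  then have "(1 - h * \<gamma>) * wbar > 0"
    using step powr_ge_zero[of "Pmax * h / (2 * M * D)" "2 / 3"] by linarith
  then have h\<gamma>: "h * \<gamma> < 1" using pos by (simp add: zero_less_mult_iff)
  have wbar_step: "(Pmax * h / (2 * M * D)) powr (2 / 3) < wbar"
  proof -
    have "(1 - h * \<gamma>) * wbar \<le> 1 * wbar"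
      using pos \<gamma> by (intro mult_right_mono) auto
    then show ?thesis using step \<open>0 < h * g * (1 + c)\<close> by linarith
  qed
  \<comment> \<open>Above \<open>wbar\<close> the power bound is strictly tighter than the bound
    \<open>g * \<mu>\<close>, as the two agree at \<open>wbar\<close>.\<close>
  have speed_le: "f < g * \<mu>" if "wbar < v" "f \<le> Pmax / (M * sqrt v)" for f v
  proof -
    have "sqrt wbar < sqrt v" using that by simp
    then have "Pmax / (M * sqrt v) < Pmax / (M * sqrt wbar)"
      using pos by (intro divide_strict_left_mono mult_strict_left_mono) auto
    then show ?thesis using that assms(16) by linarith
  qed
  have rate: "1 / (2 * v * sqrt v) < M / (Pmax * h) + lam * \<gamma> * M" if "wbar < v" for v
  proof -
    have "Pmax * h / (2 * M * D) < v * sqrt v"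
      using that wbar_step pos D by (intro less_mult_sqrt_if_powr_less) auto
    moreover have "v > 0" using that pos by simp
    ultimately have "1 / (2 * v * sqrt v) < M * D / (Pmax * h)"
      using pos D by (simp add: field_simps)
    also have "\<dots> = M / (Pmax * h) + lam * \<gamma> * M"
      using pos by (simp add: D_def field_simps)
    finally show ?thesis .
  qed

  \<comment> \<open>The power constraint at an optimum of (R)\<close>
  have power: "M * fs i / Pmax \<le> 1 / sqrt (ws i)" if "i \<in> {1..n-1}" for i
  proof (rule ccontr)
    define V where "V = {k \<in> {1..n-1}. 1 / sqrt (ws k) < M * fs k / Pmax}"
    assume "\<not> M * fs i / Pmax \<le> 1 / sqrt (ws i)"
    then have "i \<in> V" using that by (simp add: V_def not_le)
    moreover have "finite V" by (simp add: V_def)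
    ultimately have "Max V \<in> V" and Vmax: "\<And>k. k \<in> V \<Longrightarrow> k \<le> Max V"
      by (auto intro: Max_in)
    define j where "j = Max V"
    have j: "j \<in> {1..n-1}" and viol: "1 / sqrt (ws j) < M * fs j / Pmax"
      using \<open>Max V \<in> V\<close> by (auto simp: V_def j_def)
    note Rj = R(3)[OF j]
    have viol': "Pmax / (M * sqrt (ws j)) < fs j"
      using viol pos Rj by (simp add: field_simps)
    have fj: "fs j > 0"
      using viol' pos Rj by (meson divide_pos_pos less_trans mult_pos_pos real_sqrt_gt_zero)
    have wj: "wbar < ws j"
    proof (rule ccontr)
      assume "\<not> wbar < ws j"
      then have "Pmax / (M * sqrt wbar) \<le> Pmax / (M * sqrt (ws j))"
        using pos Rj by (intro divide_left_mono mult_left_mono) auto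
      then show False using viol' Rj assms(16) by linarith
    qed
    define s where "s = g * (sin (\<alpha> j) + c)"
    have wn: "wbar < ws (j + 1)"
    proof (rule ccontr)
      assume contra: "\<not> wbar < ws (j + 1)"
      \<comment> \<open>From squared speed \<open>W\<close>, zero force leads exactly to
        \<open>wbar\<close>. Since \<open>fs j > 0\<close> and the next value is at most
        \<open>wbar\<close>, \<open>ws j\<close> must lie below \<open>W\<close>.\<close>
      define W where "W = (wbar + h * s) / (1 - h * \<gamma>)"
      have fj_eq: "h * fs j = ws (j + 1) - (1 - h * \<gamma>) * ws j + h * s"
      proof -
        have "fs j = 1 / h * (ws (j + 1) - ws j) + \<gamma> * ws j + s"
          using R(4)[OF j] by (simp add: s_def)
        then show ?thesis using pos by (simp add: field_simps)
      qed
      have "0 < h * fs j" using pos fj by simp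
      then have "ws j * (1 - h * \<gamma>) < wbar + h * s"
        using fj_eq contra by (simp add: mult.commute)
      then have wW: "ws j < W" using h\<gamma> by (simp add: W_def pos_less_divide_eq)
      \<comment> \<open>The squared speed drops from above \<open>wbar\<close> to at most
        \<open>wbar\<close>, so the difference quotient in \<open>fs j\<close> is negative.\<close>
      have "h * fs j \<le> h * (\<gamma> * ws j + s)"
        using fj_eq wj contra by (simp add: algebra_simps)
      then have "fs j \<le> \<gamma> * ws j + s" using pos by simp
      moreover have "\<gamma> * ws j \<le> \<gamma> * W" using wW \<gamma> by simp
      \<comment> \<open>This is nonnegativity of the bracket in the minimum condition at
        \<open>j\<close>, rewritten with \<open>W\<close>; \<open>j\<close> is in \<open>I\<close>
        because \<open>wbar < ws j\<close> and \<open>ws j \<le> wmax j\<close>.\<close>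
      moreover have "\<gamma> * W + s \<le> Pmax / (M * sqrt W)"
      proof -
        have "finite I" using assms(18) by simp
        have jn: "j \<in> {1..n}" using j by auto
        then have jI: "j \<in> I" using assms(18) wj R(1)[OF jn] by simp
        define G where "G k = Pmax / M * sqrt ((1 - h * \<gamma>) / (wbar + h * g * (sin (\<alpha> k) + c)))
            - \<gamma> / (1 - h * \<gamma>) * (wbar + h * g * (sin (\<alpha> k) + c)) - g * (sin (\<alpha> k) + c)" for k
        have "0 \<le> Min (G ` I)"
          using assms(19) jI unfolding G_def by blast
        also have "\<dots> \<le> G j"
          using \<open>finite I\<close> jI by (intro Min_le) auto
        finally have "0 \<le> G j" .
        then have "0 \<le> Pmax / M * sqrt (1 / W) - \<gamma> * W - s"
          by (simp add: G_def W_def s_def mult.assoc)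
        then show ?thesis by (simp add: real_sqrt_divide)
      qed
      moreover have "Pmax / (M * sqrt W) \<le> Pmax / (M * sqrt (ws j))"
        using pos wW Rj by (intro divide_left_mono mult_left_mono) auto
      ultimately show False using viol' by linarith
    qed
    have fn: "fs (j + 1) < g * \<mu>" if "j + 1 \<in> {1..n-1}"
    proof (rule speed_le[OF wn])
      have "j + 1 \<notin> V" using Vmax[of "j + 1"] by (auto simp: j_def)
      then have "M * fs (j + 1) / Pmax \<le> 1 / sqrt (ws (j + 1))"
        using that by (auto simp: V_def)
      then show "fs (j + 1) \<le> Pmax / (M * sqrt (ws (j + 1)))"
        using pos R(3)[OF that] by (simp add: field_simps)
    qed
    have "ws (j + 1) > 0" using wn pos by simp
    from R_descent[OF pos(1,2) \<gamma> pos(7,8) assms(11) h\<gamma> Rf j viol this rate[OF wn] fn]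
    show False using Rmin by metis
  qed

  \<comment> \<open>Feasibility for (P)\<close>
  have Pf: "P_feasible n h M g \<mu> c \<Gamma> Pmax \<alpha> wmax winit (ws, \<lambda>i. M * fs i)"
    unfolding P_feasible_def prod.case
  proof (intro conjI ballI)
    fix k assume k: "k \<in> {1..n-1}"
    note Rk = R(3)[OF k]
    show "0 < ws k" using Rk by blast
    have "\<bar>M * fs k\<bar> = M * \<bar>fs k\<bar>" using pos by (simp add: abs_mult)
    also have "\<dots> \<le> M * (g * \<mu>)" using Rk pos by (intro mult_left_mono) auto
    finally show "\<bar>M * fs k\<bar> \<le> M * g * \<mu>" by (simp add: mult.assoc)
    show "M * fs k * sqrt (ws k) \<le> Pmax"
      using power[OF k] Rk pos by (simp add: field_simps)
    show "M / h * (ws (k + 1) - ws k) = - \<Gamma> * ws k + M * fs k - M * g * sin (\<alpha> k) - M * g * c"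
      by (simp add: R(4)[OF k] \<Gamma> algebra_simps)
  qed (use R in auto)

  \<comment> \<open>Comparison of the two objectives\<close>
  have max_M: "max (\<eta> * (M * x)) (M * x) = M * max (\<eta> * x) x" for x
    using pos by (simp add: max_mult_distrib_left mult.left_commute)
  have "P_objective n h lam \<eta> (ws, \<lambda>i. M * fs i) \<le> R_objective n h M lam \<eta> (ws, ts, fs)"
    unfolding P_objective_def R_objective_def prod.case
  proof (intro sum_mono mult_left_mono add_mono)
    fix k assume "k \<in> {1..n-1}"
    then show "1 / sqrt (ws k) \<le> ts k" using R(3) by blast
    show "lam * max (\<eta> * (M * fs k)) (M * fs k) \<le> lam * M * max (\<eta> * fs k) (fs k)"
      by (simp add: max_M)
  qed (use pos in auto)
  moreover have "R_objective n h M lam \<eta> (ws, ts, fs) \<le> P_objective n h lam \<eta> (w, F)"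
    if P: "P_feasible n h M g \<mu> c \<Gamma> Pmax \<alpha> wmax winit (w, F)" for w F
  proof -
    \<comment> \<open>With \<open>t\<close> equal to \<open>1 / sqrt (w i)\<close> the costs
      coincide, and the power constraint of (P) becomes the second lower bound on
      \<open>t\<close>.\<close>
    have "R_feasible n h M g \<mu> c \<gamma> Pmax \<alpha> wmax winit (w, \<lambda>i. 1 / sqrt (w i), \<lambda>i. F i / M)"
      unfolding R_feasible_def prod.case
    proof (intro conjI ballI)
      fix k assume k: "k \<in> {1..n-1}"
      have Pk: "0 < w k" "\<bar>F k\<bar> \<le> M * g * \<mu>" "F k * sqrt (w k) \<le> Pmax"
        "M / h * (w (k + 1) - w k) = - \<Gamma> * w k + F k - M * g * sin (\<alpha> k) - M * g * c"
        using P k unfolding P_feasible_def prod.case by blast+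
      show "0 < w k" by fact
      show "\<bar>F k / M\<bar> \<le> g * \<mu>" using Pk(2) pos by (simp add: field_simps)
      show "M * (F k / M) / Pmax \<le> 1 / sqrt (w k)"
        using Pk(1,3) pos by (simp add: field_simps)
      have "F k = M / h * (w (k + 1) - w k) + M * \<gamma> * w k + M * g * sin (\<alpha> k) + M * g * c"
        using Pk(4) by (simp add: \<Gamma>)
      also have "\<dots> / M = 1 / h * (w (k + 1) - w k) + \<gamma> * w k + g * (sin (\<alpha> k) + c)"
        using pos by (simp add: field_simps)
      finally show "F k / M = 1 / h * (w (k + 1) - w k) + \<gamma> * w k + g * (sin (\<alpha> k) + c)" .
    qed (use P in \<open>auto simp: P_feasible_def\<close>)
    from Rmin[OF this] have "R_objective n h M lam \<eta> (ws, ts, fs)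
        \<le> R_objective n h M lam \<eta> (w, \<lambda>i. 1 / sqrt (w i), \<lambda>i. F i / M)"
      by (simp only: not_less)
    also have "\<dots> = P_objective n h lam \<eta> (w, F)"
      using max_M[of "F k / M" for k] pos
      by (simp add: R_objective_def P_objective_def mult.assoc)
    finally show ?thesis .
  qed
  ultimately show ?thesis
    using Pf by (fastforce simp: is_arg_min_def)
qed

end
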